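(* Consider one of the following two settings. (1) $E$ is a standard Borel space, $X=E^{\mathbb{N}}$, $\mu$ is a Borel probability measure on $E$, and $m_x=\mu\times\delta_x$ for $x\in X$. (2) $X=\ell^p(\mathbb{N})$ with $1\leqslant p<\infty$, $(\alpha_n)_{n\geqslant 1}$ is a sequence with $\alpha_n\in(c,c')$ for some fixed $0<c<c'$, $S(x)=(\alpha_1^{-1}x_1,\alpha_2^{-1}x_2,\ldots)$, $\mu$ is a fully supported Borel probability measure on $\mathbb{R}$, and $m_x=\mu\times\delta_{S(x)}$ for $x\in X$. Let $f\in C_b(X,\mathbb{R})$, $\mathsf{M}=(m_x)_{x\in X}$, and let $\nu$ be a conformal measure of $\mathscr{L}_{\mathsf{M},f}$. Let $\mathrm{dom}(L)$ be the set of all $\varphi\in\mathcal{L}^1(\nu)$ such that the integral $$L\varphi(x)=\int_Xe^{f(y)}\varphi(y)\,dm_x(y)$$ makes sense for all $x\in X$. Then the map $L:\mathrm{dom}(L)\subset\mathcal{L}^1(\nu)\to\mathcal{L}^1(\nu)$ is well defined (i.e. $L\varphi\in\mathcal{L}^1(\nu)$ for all $\varphi\in\mathrm{dom}(L)$) and preserves $\nu$-equivalence classes: if $\varphi,\psi\in\mathrm{dom}(L)$ and $\varphi=\psi$ $\nu$-a.e., then $L\varphi=L\psi$ $\nu$-a.e.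
   Context: A standard Borel space $E$ is taken with a complete separable metric $d_E$, and $E^{\mathbb{N}}$ has the metric $d(x,y)=\sum_{n\geqslant1}2^{-n}\min\{d_E(x_n,y_n),1\}$. $C_b(X,\mathbb{R})$ is the space of bounded continuous real functions with the supremum norm; $\mathcal{L}^1(\nu)$ is the space of $\nu$-integrable Borel functions (not equivalence classes). In setting (1), $\mu\times\delta_x$ is the law on $E^{\mathbb{N}}$ of $ax=(a,x_1,x_2,\ldots)$ with $a\sim\mu$; in setting (2), identifying $\mathbb{R}\times\ell^p(\mathbb{N})$ with $\ell^p(\mathbb{N})$, $\mu\times\delta_{S(x)}$ is the law of $(r,x_1/\alpha_1,x_2/\alpha_2,\ldots)$ with $r\sim\mu$. The transfer operator is $\mathscr{L}_{\mathsf{M},f}\varphi(x)=\int_Xe^{f(y)}\varphi(y)\,dm_x(y)$ for $\varphi\in C_b(X,\mathbb{R})$. A conformal measure is a Borel probability measure $\nu$ with $\int\mathscr{L}_{\mathsf{M},f}\varphi\,d\nu=\varrho\int\varphi\,d\nu$ for all $\varphi\in C_b(X,\mathbb{R})$, where $\varrho$ is the spectral radius of $\mathscr{L}_{\mathsf{M},f}$ on $C_b(X,\mathbb{R})$. "Makes sense" means that $y\mapsto e^{f(y)}\varphi(y)$ is $m_x$-integrable. *)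

theory Defs
  imports "HOL-Probability.Probability"
begin

definition borel_of :: "'x topology \<Rightarrow> 'x measure" where
  "borel_of X = sigma (topspace X) {U. openin X U}"

definition is_borel_prob :: "'x topology \<Rightarrow> 'x measure \<Rightarrow> bool" where
  "is_borel_prob X \<nu> \<longleftrightarrow> prob_space \<nu> \<and> sets \<nu> = sets (borel_of X)"

definition fully_supported :: "'x topology \<Rightarrow> 'x measure \<Rightarrow> bool" where
  "fully_supported X \<mu> \<longleftrightarrow> (\<forall>U. openin X U \<and> U \<noteq> {} \<longrightarrow> emeasure \<mu> U > 0)"


section \<open>Bounded continuous functions and the spectral radius\<close>

text \<open>
  Functions on the carrier of \<open>X\<close> are represented by extensional functions, so that equality
  in \<open>Cb X\<close> is equality on the carrier.
\<close>

definition Cb :: "'x topology \<Rightarrow> ('x \<Rightarrow> 'b::real_normed_vector) set" where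
  "Cb X = {\<phi> \<in> extensional (topspace X).
             continuous_map X euclidean \<phi> \<and> bounded (\<phi> ` topspace X)}"

definition supnorm :: "'x topology \<Rightarrow> ('x \<Rightarrow> 'b::real_normed_vector) \<Rightarrow> real" where
  "supnorm X \<phi> = (SUP x\<in>topspace X. norm (\<phi> x))"

text \<open>
  As usual, the spectrum of an operator \<open>T\<close> on the real space of bounded continuous functions is
  that of its complexification, which acts on the complex-valued bounded continuous functions
  by \<open>u + i v \<mapsto> T u + i T v\<close>.
\<close>

definition complexify ::
    "(('x \<Rightarrow> real) \<Rightarrow> 'x \<Rightarrow> real) \<Rightarrow> ('x \<Rightarrow> complex) \<Rightarrow> 'x \<Rightarrow> complex" where
  "complexify T \<phi> x = Complex (T (\<lambda>y. Re (\<phi> y)) x) (T (\<lambda>y. Im (\<phi> y)) x)"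

definition invertible_on_Cb ::
    "'x topology \<Rightarrow> (('x \<Rightarrow> complex) \<Rightarrow> 'x \<Rightarrow> complex) \<Rightarrow> bool" where
  "invertible_on_Cb X A \<longleftrightarrow>
     bij_betw A (Cb X) (Cb X) \<and> (\<exists>K. \<forall>\<phi>\<in>Cb X. supnorm X \<phi> \<le> K * supnorm X (A \<phi>))"

definition spectrum_Cb :: "'x topology \<Rightarrow> (('x \<Rightarrow> real) \<Rightarrow> 'x \<Rightarrow> real) \<Rightarrow> complex set" where
  "spectrum_Cb X T =
     {\<zeta>. \<not> invertible_on_Cb X (\<lambda>\<phi>. \<lambda>x\<in>topspace X. complexify T \<phi> x - \<zeta> * \<phi> x)}"

definition spectral_radius_Cb :: "'x topology \<Rightarrow> (('x \<Rightarrow> real) \<Rightarrow> 'x \<Rightarrow> real) \<Rightarrow> real" where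
  "spectral_radius_Cb X T = (SUP \<zeta>\<in>spectrum_Cb X T. cmod \<zeta>)"


section \<open>Transfer operators\<close>

text \<open>The same formula serves for the operator on \<open>Cb X\<close> and for its extension to \<open>L1_dom\<close>.\<close>

definition transfer ::
    "('x \<Rightarrow> 'x measure) \<Rightarrow> ('x \<Rightarrow> real) \<Rightarrow> ('x \<Rightarrow> real) \<Rightarrow> 'x \<Rightarrow> real" where
  "transfer m f \<phi> x = (\<integral>y. exp (f y) * \<phi> y \<partial>m x)"

definition conformal ::
    "'x topology \<Rightarrow> ('x \<Rightarrow> 'x measure) \<Rightarrow> ('x \<Rightarrow> real) \<Rightarrow> 'x measure \<Rightarrow> bool" where
  "conformal X m f \<nu> \<longleftrightarrow>
     is_borel_prob X \<nu> \<and>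
     (\<forall>\<phi>\<in>Cb X. (\<integral>x. transfer m f \<phi> x \<partial>\<nu>)
                = spectral_radius_Cb X (transfer m f) * (\<integral>x. \<phi> x \<partial>\<nu>))"

definition L1_dom ::
    "'x topology \<Rightarrow> ('x \<Rightarrow> 'x measure) \<Rightarrow> ('x \<Rightarrow> real) \<Rightarrow> 'x measure \<Rightarrow> ('x \<Rightarrow> real) set" where
  "L1_dom X m f \<nu> =
     {\<phi>. integrable \<nu> \<phi> \<and> (\<forall>x\<in>topspace X. integrable (m x) (\<lambda>y. exp (f y) * \<phi> y))}"


section \<open>Sequence spaces\<close>

text \<open>
  Sequences are indexed from 0. On \<open>nat \<Rightarrow> 'e\<close> with \<open>'e\<close> a Polish space, \<open>euclidean\<close> is the product
  topology, i.e. the topology of the metric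
  \<open>d x y = (\<Sum>n. 2 powi (- n) * min (dist (x n) (y n)) 1)\<close>.
\<close>

definition prepend_law :: "'e measure \<Rightarrow> (nat \<Rightarrow> 'e) topology \<Rightarrow> (nat \<Rightarrow> 'e) \<Rightarrow> (nat \<Rightarrow> 'e) measure" where
  "prepend_law \<mu> X x = distr \<mu> (borel_of X) (\<lambda>a. case_nat a x)"

definition lp_space :: "real \<Rightarrow> (nat \<Rightarrow> real) set" where
  "lp_space p = {x. summable (\<lambda>n. \<bar>x n\<bar> powr p)}"

definition lp_norm :: "real \<Rightarrow> (nat \<Rightarrow> real) \<Rightarrow> real" where
  "lp_norm p x = (\<Sum>n. \<bar>x n\<bar> powr p) powr (1 / p)"

definition lp_topology :: "real \<Rightarrow> (nat \<Rightarrow> real) topology" where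
  "lp_topology p = Metric_space.mtopology (lp_space p) (\<lambda>x y. lp_norm p (\<lambda>n. x n - y n))"

definition inverse_weights :: "(nat \<Rightarrow> real) \<Rightarrow> (nat \<Rightarrow> real) \<Rightarrow> nat \<Rightarrow> real" where
  "inverse_weights \<alpha> x = (\<lambda>n. inverse (\<alpha> n) * x n)"


text \<open>The topology of \<open>lp_topology\<close> is the intended one because its distance is a metric.\<close>

lemma powr_convex_nonneg:
  fixes p t u v :: real
  assumes p: "1 \<le> p" and t: "0 \<le> t" "t \<le> 1" and u: "0 \<le> u" and v: "0 \<le> v"
  shows "(t * u + (1 - t) * v) powr p \<le> t * u powr p + (1 - t) * v powr p"
proof -
  have shrink: "(s * w) powr p \<le> s * w powr p" if "0 \<le> s" "s \<le> 1" "0 \<le> w" for s w :: real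
  proof -
    have "s powr p \<le> s powr 1" if "s > 0"
      using p \<open>s \<le> 1\<close> that by (intro powr_mono') auto
    hence "s powr p \<le> s" using \<open>0 \<le> s\<close> by (cases "s = 0") auto
    thus ?thesis using that by (simp add: powr_mult mult_right_mono)
  qed
  consider "u = 0" | "v = 0" | "u > 0" "v > 0" using u v by linarith
  thus ?thesis
  proof cases
    case 1 thus ?thesis using shrink[of "1 - t" v] t v p by simp
  next
    case 2 thus ?thesis using shrink[of t u] t u p by simp
  next
    case 3
    have "convex_on {0<..} (\<lambda>x::real. x powr p)" using p by (rule powr_convex)
    from convex_onD[OF this, of t v u] 3 t show ?thesis
      by (simp add: add.commute)
  qed
qed

lemma lp_space_diff:
  assumes p: "1 \<le> p" and x: "x \<in> lp_space p" and y: "y \<in> lp_space p"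
  shows "(\<lambda>n. x n - y n) \<in> lp_space p"
proof -
  have le: "\<bar>x n - y n\<bar> powr p \<le> 2 powr p * (\<bar>x n\<bar> powr p + \<bar>y n\<bar> powr p)" for n
  proof -
    have "\<bar>x n - y n\<bar> powr p \<le> (2 * max \<bar>x n\<bar> \<bar>y n\<bar>) powr p"
      using p by (intro powr_mono2) auto
    also have "\<dots> = 2 powr p * (max \<bar>x n\<bar> \<bar>y n\<bar>) powr p" by (simp add: powr_mult)
    also have "\<dots> \<le> 2 powr p * (\<bar>x n\<bar> powr p + \<bar>y n\<bar> powr p)"
      by (intro mult_left_mono) (auto simp: max_def)
    finally show ?thesis .
  qed
  have "summable (\<lambda>n. 2 powr p * (\<bar>x n\<bar> powr p + \<bar>y n\<bar> powr p))"
    using x y by (intro summable_mult summable_add) (auto simp: lp_space_def)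
  hence "summable (\<lambda>n. \<bar>x n - y n\<bar> powr p)"
    by (rule summable_comparison_test'[where N = 0]) (simp add: le)
  thus ?thesis by (simp add: lp_space_def)
qed

lemma lp_norm_nonneg: "0 \<le> lp_norm p x"
  by (simp add: lp_norm_def)

lemma lp_norm_powr:
  assumes "1 \<le> p" "x \<in> lp_space p"
  shows "lp_norm p x powr p = (\<Sum>n. \<bar>x n\<bar> powr p)"
  using assms by (simp add: lp_norm_def powr_powr lp_space_def suminf_nonneg)

lemma lp_norm_eq_0:
  assumes p: "1 \<le> p" and x: "x \<in> lp_space p"
  shows "lp_norm p x = 0 \<longleftrightarrow> (\<forall>n. x n = 0)"
  using p x suminf_eq_zero_iff[of "\<lambda>n. \<bar>x n\<bar> powr p"]
  by (auto simp: lp_norm_def lp_space_def)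

lemma lp_norm_triangle:
  assumes p: "1 \<le> p" and x: "x \<in> lp_space p" and y: "y \<in> lp_space p"
    and z: "z \<in> lp_space p" and le: "\<And>n. \<bar>z n\<bar> \<le> \<bar>x n\<bar> + \<bar>y n\<bar>"
  shows "lp_norm p z \<le> lp_norm p x + lp_norm p y"
proof -
  let ?a = "lp_norm p x" and ?b = "lp_norm p y"
  have mono: "lp_norm p z \<le> lp_norm p w" if "w \<in> lp_space p" "\<And>n. \<bar>z n\<bar> \<le> \<bar>w n\<bar>" for w
    unfolding lp_norm_def using p z that
    by (intro powr_mono2 suminf_le suminf_nonneg) (auto simp: lp_space_def intro: powr_mono2)
  consider "?a = 0" | "?b = 0" | "?a > 0" "?b > 0"
    using lp_norm_nonneg[of p x] lp_norm_nonneg[of p y] by linarith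
  thus ?thesis
  proof cases
    case 1
    hence "\<forall>n. x n = 0" using lp_norm_eq_0[OF p x] by simp
    thus ?thesis using mono[OF y] le 1 by simp
  next
    case 2
    hence "\<forall>n. y n = 0" using lp_norm_eq_0[OF p y] by simp
    thus ?thesis using mono[OF x] le 2 by simp
  next
    case 3
    define t where "t = ?a / (?a + ?b)"
    have t: "0 \<le> t" "t \<le> 1" "1 - t = ?b / (?a + ?b)"
      using 3 by (auto simp: t_def field_simps)
    have pt: "(\<bar>z n\<bar> / (?a + ?b)) powr p
        \<le> t * (\<bar>x n\<bar> powr p / ?a powr p) + (1 - t) * (\<bar>y n\<bar> powr p / ?b powr p)" for n
    proof -
      have "\<bar>z n\<bar> / (?a + ?b) \<le> (\<bar>x n\<bar> + \<bar>y n\<bar>) / (?a + ?b)"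
        using le[of n] 3 by (intro divide_right_mono) auto
      also have "\<dots> = t * (\<bar>x n\<bar> / ?a) + (1 - t) * (\<bar>y n\<bar> / ?b)"
        using 3 unfolding t(3) by (simp add: t_def add_divide_distrib)
      finally have "(\<bar>z n\<bar> / (?a + ?b)) powr p
          \<le> (t * (\<bar>x n\<bar> / ?a) + (1 - t) * (\<bar>y n\<bar> / ?b)) powr p"
        using p 3 by (intro powr_mono2) auto
      also have "\<dots> \<le> t * (\<bar>x n\<bar> / ?a) powr p + (1 - t) * (\<bar>y n\<bar> / ?b) powr p"
        using 3 by (intro powr_convex_nonneg[OF p t(1,2)]) auto
      finally show ?thesis using 3 by (simp add: powr_divide)
    qed
    have sx: "(\<lambda>n. \<bar>x n\<bar> powr p) sums (?a powr p)"
      and sy: "(\<lambda>n. \<bar>y n\<bar> powr p) sums (?b powr p)"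
      and sz: "(\<lambda>n. \<bar>z n\<bar> powr p) sums (lp_norm p z powr p)"
      using x y z lp_norm_powr[OF p] by (auto simp: lp_space_def summable_sums)
    have "(\<lambda>n. t * (\<bar>x n\<bar> powr p / ?a powr p) + (1 - t) * (\<bar>y n\<bar> powr p / ?b powr p))
        sums (t * (?a powr p / ?a powr p) + (1 - t) * (?b powr p / ?b powr p))"
      by (intro sums_add sums_mult sums_divide sx sy)
    hence R: "(\<lambda>n. t * (\<bar>x n\<bar> powr p / ?a powr p) + (1 - t) * (\<bar>y n\<bar> powr p / ?b powr p)) sums 1"
      using 3 by simp
    have L: "(\<lambda>n. (\<bar>z n\<bar> / (?a + ?b)) powr p) sums (lp_norm p z powr p / (?a + ?b) powr p)"
      using sums_divide[OF sz, of "(?a + ?b) powr p"] 3 by (simp add: powr_divide)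
    have "lp_norm p z powr p / (?a + ?b) powr p \<le> 1"
      using sums_le[OF _ L R] pt by blast
    hence "lp_norm p z powr p \<le> (?a + ?b) powr p"
      using 3 by (simp add: divide_le_eq)
    thus ?thesis
      using p 3 powr_less_mono2[of p "?a + ?b" "lp_norm p z"] by linarith
  qed
qed

lemma Metric_space_lp:
  assumes p: "1 \<le> p"
  shows "Metric_space (lp_space p) (\<lambda>x y. lp_norm p (\<lambda>n. x n - y n))"
proof
  fix x y z
  show "0 \<le> lp_norm p (\<lambda>n. x n - y n)" by (rule lp_norm_nonneg)
  show "lp_norm p (\<lambda>n. x n - y n) = lp_norm p (\<lambda>n. y n - x n)"
    by (simp add: lp_norm_def abs_minus_commute)
  assume x: "x \<in> lp_space p" and y: "y \<in> lp_space p"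
  show "lp_norm p (\<lambda>n. x n - y n) = 0 \<longleftrightarrow> x = y"
    using lp_norm_eq_0[OF p lp_space_diff[OF p x y]] by auto
  assume z: "z \<in> lp_space p"
  show "lp_norm p (\<lambda>n. x n - z n) \<le> lp_norm p (\<lambda>n. x n - y n) + lp_norm p (\<lambda>n. y n - z n)"
    by (rule lp_norm_triangle[OF p lp_space_diff[OF p x y] lp_space_diff[OF p y z]
          lp_space_diff[OF p x z]]) linarith
qed

lemma topspace_lp: "1 \<le> p \<Longrightarrow> topspace (lp_topology p) = lp_space p"
  by (simp add: lp_topology_def Metric_space.topspace_mtopology[OF Metric_space_lp])

end

theory Submission
  imports Defs
begin

text \<open>
  Integrating the measures \<open>e\<^sup>f m\<^sub>x\<close> against \<open>\<nu>\<close> gives a finite Borel measure \<open>\<eta>\<close>. The eigenmeasure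
  equation says that \<open>\<eta>\<close> and \<open>\<rho> \<nu>\<close> have the same integrals of bounded continuous functions, so they
  agree because the space is metrizable. Hence \<open>\<nu>\<close>-integrable functions are \<open>\<eta>\<close>-integrable and
  \<open>\<nu>\<close>-null sets are \<open>\<eta>\<close>-null, and both claims follow from Fubini's theorem, because \<open>\<eta>\<close> is the image
  of a measure with positive density with respect to \<open>\<nu> \<times> \<mu>\<close>. This needs joint measurability of
  the branch map \<open>T\<close> with \<open>m\<^sub>x\<close> the law of \<open>T x a\<close> for \<open>a \<sim> \<mu>\<close>, that is, of
  \<open>(x, a) \<mapsto> T x a\<close>; on \<open>\<ell>\<^sup>p\<close> it reduces to measurability of the coordinates, because by separability
  open sets are countable unions of balls.
\<close>

section \<open>Borel sets and Borel functions of an abstract topology\<close>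

lemma space_borel_of [simp]: "space (borel_of X) = topspace X"
  by (auto simp: borel_of_def space_measure_of_conv)

lemma sets_borel_of: "sets (borel_of X) = sigma_sets (topspace X) {U. openin X U}"
  unfolding borel_of_def by (rule sets_measure_of) (auto dest: openin_subset)

lemma openin_sets_borel_of: "openin X U \<Longrightarrow> U \<in> sets (borel_of X)"
  by (auto simp: sets_borel_of)

lemma closedin_sets_borel_of:
  assumes "closedin X C" shows "C \<in> sets (borel_of X)"
proof -
  have "topspace X - (topspace X - C) \<in> sets (borel_of X)"
    using assms by (intro sets.Diff openin_sets_borel_of) auto
  thus ?thesis using closedin_subset[OF assms] by (simp add: double_diff)
qed

text \<open>Closed sets are preferred as a generator because, on a metrizable space, their
  indicators are pointwise limits of bounded continuous functions; they are also stable under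
  intersection.\<close>

lemma sets_borel_of_closed: "sets (borel_of X) = sigma_sets (topspace X) {C. closedin X C}"
proof
  show "sigma_sets (topspace X) {C. closedin X C} \<subseteq> sets (borel_of X)"
    using sets.sigma_sets_subset[of "{C. closedin X C}" "borel_of X"] closedin_sets_borel_of by auto
  show "sets (borel_of X) \<subseteq> sigma_sets (topspace X) {C. closedin X C}"
    unfolding sets_borel_of
  proof (rule sigma_sets_mono, safe)
    fix U assume U: "openin X U"
    have "topspace X - (topspace X - U) \<in> sigma_sets (topspace X) {C. closedin X C}"
      using U by (intro sigma_sets.Compl sigma_sets.Basic) auto
    thus "U \<in> sigma_sets (topspace X) {C. closedin X C}"
      using openin_subset[OF U] by (simp add: double_diff)
  qed
qed

lemma borel_of_euclidean: "sets (borel_of euclidean) = sets borel"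
  by (simp add: sets_borel_of sets_borel)

lemma measurable_borel_ofI:
  assumes "\<And>w. w \<in> space M \<Longrightarrow> g w \<in> topspace X"
    and "\<And>U. openin X U \<Longrightarrow> g -` U \<inter> space M \<in> sets M"
  shows "g \<in> measurable M (borel_of X)"
  unfolding borel_of_def using assms by (intro measurable_measure_of) (auto dest: openin_subset)

lemma continuous_map_borel_measurable:
  assumes "continuous_map X euclidean f" shows "f \<in> borel_measurable (borel_of X)"
proof (rule borel_measurableI)
  fix S :: "'b set" assume "open S"
  hence "openin X {x \<in> topspace X. f x \<in> S}"
    using assms by (simp add: openin_continuous_map_preimage)
  thus "f -` S \<inter> space (borel_of X) \<in> sets (borel_of X)"
    using openin_sets_borel_of by (simp add: vimage_def Collect_conj_eq Int_commute)
qed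

lemma Cb_borel_measurable: "\<phi> \<in> Cb X \<Longrightarrow> \<phi> \<in> borel_measurable (borel_of X)"
  by (simp add: Cb_def continuous_map_borel_measurable)

section \<open>Bounded continuous functions determine finite Borel measures\<close>

text \<open>In a metrizable space a closed set is a decreasing intersection of open sets
  \<open>U n\<close>. Urysohn functions equal to 1 on \<open>C\<close> and 0 off \<open>U n\<close>
  converge pointwise to the indicator.\<close>

lemma closedin_indicator_limit_Cb:
  assumes X: "metrizable_space X" and C: "closedin X C"
  obtains \<phi> :: "nat \<Rightarrow> 'x \<Rightarrow> real" where "\<And>n. \<phi> n \<in> Cb X"
    "\<And>n x. x \<in> topspace X \<Longrightarrow> \<bar>\<phi> n x\<bar> \<le> 1"
    "\<And>x. x \<in> topspace X \<Longrightarrow> (\<lambda>n. \<phi> n x) \<longlonglongrightarrow> indicator C x"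
proof -
  obtain U where U: "\<And>n. openin X (U n)" "\<And>n. U (Suc n) \<subseteq> U n" "\<Inter>(range U) = C"
    using closed_imp_gdelta_in[OF X C] unfolding gdelta_in_descending by blast
  have "\<exists>g. continuous_map X (top_of_set {0..1::real}) g \<and> g ` C \<subseteq> {1} \<and> g ` (topspace X - U n) \<subseteq> {0}" for n
  proof -
    have "disjnt (topspace X - U n) C" "closedin X (topspace X - U n)"
      using U by (auto simp: disjnt_def)
    then show ?thesis
      using Urysohn_lemma[OF metrizable_imp_normal_space[OF X] _ C, of "topspace X - U n" 0 1]
      by (metis zero_le_one)
  qed
  then obtain g where g: "\<And>n. continuous_map X (top_of_set {0..1::real}) (g n)"
    "\<And>n. g n ` C \<subseteq> {1}" "\<And>n. g n ` (topspace X - U n) \<subseteq> {0}"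
    by metis
  have g01: "0 \<le> g n x" "g n x \<le> 1" if "x \<in> topspace X" for n x
    using continuous_map_image_subset_topspace[OF g(1)[of n]] that by auto
  show thesis
  proof
    fix n x assume x: "x \<in> topspace X"
    show "\<bar>restrict (g n) (topspace X) x\<bar> \<le> 1" using g01[OF x, of n] x by simp
  next
    fix n
    have "continuous_map X euclidean (g n)"
      using g(1) continuous_map_into_fulltopology by blast
    \<comment> \<open>Members of \<open>Cb X\<close> are extensional, so the Urysohn function has to
      be restricted to the carrier.\<close>
    hence "continuous_map X euclidean (restrict (g n) (topspace X))"
      by (rule continuous_map_eq) simp
    moreover have "bounded (restrict (g n) (topspace X) ` topspace X)"
      using g01 by (auto intro!: boundedI[of _ 1])
    ultimately show "restrict (g n) (topspace X) \<in> Cb X"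
      by (simp add: Cb_def)
  next
    fix x assume x: "x \<in> topspace X"
    show "(\<lambda>n. restrict (g n) (topspace X) x) \<longlonglongrightarrow> indicator C x"
    proof (cases "x \<in> C")
      case True
      hence "g n x = 1" for n using g(2)[of n] by auto
      thus ?thesis using x True by simp
    next
      case False
      then obtain N where N: "x \<notin> U N" using U(3) by auto
      \<comment> \<open>Once \<open>x\<close> has left \<open>U N\<close> it stays outside all later
        \<open>U n\<close>, so the sequence is eventually constant 0.\<close>
      have "g n x = 0" if "n \<ge> N" for n
      proof -
        have "U n \<subseteq> U N" using that U(2) by (metis lift_Suc_antimono_le)
        thus ?thesis using N g(3)[of n] x by auto
      qed
      thus ?thesis using x False
        by (intro tendsto_eventually eventually_sequentiallyI[of N]) auto
    qed
  qed
qed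

text \<open>Dominated convergence along continuous approximations of the indicator gives equal mass
  to every closed set; uniqueness on an intersection-stable generator does the rest.\<close>

lemma finite_measure_eqI_Cb:
  fixes M N :: "'x measure"
  assumes X: "metrizable_space X"
    and M: "finite_measure M" "sets M = sets (borel_of X)"
    and N: "finite_measure N" "sets N = sets (borel_of X)"
    and eq: "\<And>\<phi> :: 'x \<Rightarrow> real. \<phi> \<in> Cb X \<Longrightarrow> (\<integral>x. \<phi> x \<partial>M) = (\<integral>x. \<phi> x \<partial>N)"
  shows "M = N"
proof (rule measure_eqI_generator_eq)
  show "Int_stable {C. closedin X C}" by (auto simp: Int_stable_def)
  show "{C. closedin X C} \<subseteq> Pow (topspace X)" by (auto dest: closedin_subset)
  show "sets M = sigma_sets (topspace X) {C. closedin X C}"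
    "sets N = sigma_sets (topspace X) {C. closedin X C}"
    using M N by (simp_all add: sets_borel_of_closed)
  show "range (\<lambda>_::nat. topspace X) \<subseteq> {C. closedin X C}" "(\<Union>i::nat. topspace X) = topspace X"
    by auto
  show "emeasure M (topspace X) \<noteq> \<infinity>"
    using finite_measure.emeasure_finite[OF M(1)] by simp
  fix C assume "C \<in> {C. closedin X C}"
  hence C: "closedin X C" by simp
  obtain \<phi> :: "nat \<Rightarrow> 'x \<Rightarrow> real" where \<phi>: "\<And>n. \<phi> n \<in> Cb X"
    "\<And>n x. x \<in> topspace X \<Longrightarrow> \<bar>\<phi> n x\<bar> \<le> 1"
    "\<And>x. x \<in> topspace X \<Longrightarrow> (\<lambda>n. \<phi> n x) \<longlonglongrightarrow> indicator C x"
    using closedin_indicator_limit_Cb[OF X C] by blast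
  have lim: "(\<lambda>n. \<integral>x. \<phi> n x \<partial>P) \<longlonglongrightarrow> measure P C"
    if P: "finite_measure P" "sets P = sets (borel_of X)" for P
  proof -
    interpret finite_measure P by fact
    have sp: "space P = topspace X" using sets_eq_imp_space_eq[OF P(2)] by simp
    have CP: "C \<in> sets P" using closedin_sets_borel_of[OF C] P(2) by simp
    have "(\<lambda>n. \<integral>x. \<phi> n x \<partial>P) \<longlonglongrightarrow> (\<integral>x. indicator C x \<partial>P)"
    proof (rule integral_dominated_convergence[where w = "\<lambda>_. 1"])
      show "\<phi> n \<in> borel_measurable P" for n
        using Cb_borel_measurable[OF \<phi>(1)] measurable_cong_sets[OF P(2) refl] by blast
    qed (use \<phi> sp CP in auto)
    thus ?thesis using CP sets.sets_into_space[OF CP] by (simp add: Int_absorb1)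
  qed
  have "measure M C = measure N C"
    using LIMSEQ_unique[OF lim[OF M]] lim[OF N] eq[OF \<phi>(1)] by simp
  thus "emeasure M C = emeasure N C"
    using M(1) N(1) by (simp add: finite_measure.emeasure_eq_measure)
qed

section \<open>The transfer operator of a general branch map\<close>

text \<open>Change of variables. It also covers non-integrable integrands, where both Bochner
  integrals take the default value 0.\<close>

lemma transfer_distr:
  assumes "T \<in> measurable \<mu> (borel_of X)" "f \<in> borel_measurable (borel_of X)"
    "\<phi> \<in> borel_measurable (borel_of X)" "m x = distr \<mu> (borel_of X) T"
  shows "transfer m f \<phi> x = (\<integral>a. exp (f (T a)) * \<phi> (T a) \<partial>\<mu>)"
proof -
  note [measurable] = assms(1-3)
  show ?thesis
    unfolding transfer_def assms(4) by (rule integral_distr) measurable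
qed

text \<open>Stated for a general branch map \<open>T\<close>, so that both settings become
  instances.\<close>

lemma transfer_L1:
  fixes X :: "'x topology" and \<mu> :: "'e measure" and T :: "'x \<Rightarrow> 'e \<Rightarrow> 'x"
  assumes X: "metrizable_space X" and \<mu>: "prob_space \<mu>"
    and T: "(\<lambda>(x, a). T x a) \<in> measurable (borel_of X \<Otimes>\<^sub>M \<mu>) (borel_of X)"
    and m: "\<And>x. x \<in> topspace X \<Longrightarrow> m x = distr \<mu> (borel_of X) (T x)"
    and f: "f \<in> Cb X" and conf: "conformal X m f \<nu>"
  shows "integrable \<nu> \<phi> \<Longrightarrow> integrable \<nu> (transfer m f \<phi>)"
    and "integrable \<nu> \<phi> \<Longrightarrow> integrable \<nu> \<psi> \<Longrightarrow> AE x in \<nu>. \<phi> x = \<psi> x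
      \<Longrightarrow> AE x in \<nu>. transfer m f \<phi> x = transfer m f \<psi> x"
proof -
  define \<rho> where "\<rho> = spectral_radius_Cb X (transfer m f)"
  have \<nu>: "prob_space \<nu>" "sets \<nu> = sets (borel_of X)"
    and eigen: "\<And>\<phi>. \<phi> \<in> Cb X \<Longrightarrow> (\<integral>x. transfer m f \<phi> x \<partial>\<nu>) = \<rho> * (\<integral>x. \<phi> x \<partial>\<nu>)"
    using conf by (auto simp: conformal_def is_borel_prob_def \<rho>_def)
  have sp: "space \<nu> = topspace X" using sets_eq_imp_space_eq[OF \<nu>(2)] by simp
  note [measurable_cong] = \<nu>(2)
  note [measurable] = T Cb_borel_measurable[OF f]
  have Tx[measurable]: "T x \<in> measurable \<mu> (borel_of X)" if "x \<in> topspace X" for x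
    using measurable_Pair2[OF T, of x] that by simp
  interpret \<mu>: prob_space \<mu> by fact
  interpret \<nu>: prob_space \<nu> by fact
  interpret P: pair_prob_space \<nu> \<mu> ..
  have trans: "transfer m f \<phi> x = (\<integral>a. exp (f (T x a)) * \<phi> (T x a) \<partial>\<mu>)"
    if "\<phi> \<in> borel_measurable \<nu>" "x \<in> space \<nu>" for \<phi> x
    using that m sp by (intro transfer_distr[where X = X]) auto
  define g where "g = (\<lambda>(x, a). exp (f (T x a)))"
  have g[measurable]: "g \<in> borel_measurable (\<nu> \<Otimes>\<^sub>M \<mu>)"
    unfolding g_def by measurable
  \<comment> \<open>The weight is applied on the product, before pushing forward, so that integrals
    and null sets of \<open>\<eta>\<close> can be read off there.\<close>
  define \<eta> where "\<eta> = distr (density (\<nu> \<Otimes>\<^sub>M \<mu>) g) (borel_of X) (\<lambda>(x, a). T x a)"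
  have intble: "integrable \<eta> \<phi> \<longleftrightarrow> integrable (\<nu> \<Otimes>\<^sub>M \<mu>) (\<lambda>(x, a). exp (f (T x a)) * \<phi> (T x a))"
    and int: "(\<integral>x. \<phi> x \<partial>\<eta>) = (\<integral>(x, a). exp (f (T x a)) * \<phi> (T x a) \<partial>(\<nu> \<Otimes>\<^sub>M \<mu>))"
    if [measurable]: "\<phi> \<in> borel_measurable \<nu>" for \<phi> :: "'x \<Rightarrow> real"
  proof -
    have [simp]: "g w * \<phi> (case w of (x, a) \<Rightarrow> T x a) =
        (case w of (x, a) \<Rightarrow> exp (f (T x a)) * \<phi> (T x a))" for w
      by (simp add: g_def split: prod.split)
    have "AE w in \<nu> \<Otimes>\<^sub>M \<mu>. 0 \<le> g w" by (simp add: g_def split: prod.split)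
    thus "integrable \<eta> \<phi> \<longleftrightarrow> integrable (\<nu> \<Otimes>\<^sub>M \<mu>) (\<lambda>(x, a). exp (f (T x a)) * \<phi> (T x a))"
      and "(\<integral>x. \<phi> x \<partial>\<eta>) = (\<integral>(x, a). exp (f (T x a)) * \<phi> (T x a) \<partial>(\<nu> \<Otimes>\<^sub>M \<mu>))"
      unfolding \<eta>_def by (simp_all add: integrable_distr_eq integral_distr integrable_density integral_density)
  qed
  obtain K where K: "\<And>x. x \<in> topspace X \<Longrightarrow> \<bar>f x\<bar> \<le> K"
    using f by (auto simp: Cb_def bounded_iff)
  have bdd: "integrable \<eta> \<phi>"
    if [measurable]: "\<phi> \<in> borel_measurable \<nu>" and b: "\<And>x. x \<in> topspace X \<Longrightarrow> \<bar>\<phi> x\<bar> \<le> B" for \<phi> :: "'x \<Rightarrow> real" and B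
  proof -
    have "norm (case w of (x, a) \<Rightarrow> exp (f (T x a)) * \<phi> (T x a)) \<le> exp K * B"
      if "w \<in> space (\<nu> \<Otimes>\<^sub>M \<mu>)" for w
    proof -
      obtain x a where w: "w = (x, a)" by force
      \<comment> \<open>The bounds on \<open>f\<close> and \<open>\<phi>\<close> hold only on the
        carrier, so \<open>T x a\<close> has to be located in it.\<close>
      have "T x a \<in> topspace X" using that measurable_space[OF Tx, of x a]
        by (auto simp: w space_pair_measure sp)
      thus ?thesis using K[of "T x a"] b[of "T x a"] by (auto simp: w abs_mult intro!: mult_mono)
    qed
    thus ?thesis unfolding intble[OF that(1)]
      by (intro P.integrable_const_bound[where B = "exp K * B"] AE_I2) auto
  qed
  have fubini: "(\<integral>x. \<phi> x \<partial>\<eta>) = (\<integral>x. transfer m f \<phi> x \<partial>\<nu>)"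
    if "\<phi> \<in> borel_measurable \<nu>" "integrable \<eta> \<phi>" for \<phi> :: "'x \<Rightarrow> real"
  proof -
    have "(\<integral>x. \<phi> x \<partial>\<eta>) = (\<integral>x. (\<integral>a. exp (f (T x a)) * \<phi> (T x a) \<partial>\<mu>) \<partial>\<nu>)"
      using P.integral_fst'[of "\<lambda>(x, a). exp (f (T x a)) * \<phi> (T x a)"] that int intble by simp
    thus ?thesis using trans[OF that(1)] by (simp cong: Bochner_Integration.integral_cong)
  qed
  have meas_eta: "finite_measure \<eta>"
  proof -
    \<comment> \<open>Integrability of the constant 1 says that the total mass is finite.\<close>
    have "integrable \<eta> (\<lambda>_. 1 :: real)" by (rule bdd[of _ 1]) auto
    thus ?thesis
      by (auto intro!: finite_measureI simp: integrable_iff_bounded less_top[symmetric])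
  qed
  have CbM: "\<phi> \<in> borel_measurable \<nu>" if "\<phi> \<in> Cb X" for \<phi> :: "'x \<Rightarrow> real"
    using Cb_borel_measurable[OF that] by measurable
  have mean: "(\<integral>x. \<phi> x \<partial>\<eta>) = \<rho> * (\<integral>x. \<phi> x \<partial>\<nu>)" if \<phi>: "\<phi> \<in> Cb X" for \<phi> :: "'x \<Rightarrow> real"
  proof -
    obtain B where "\<And>x. x \<in> topspace X \<Longrightarrow> \<bar>\<phi> x\<bar> \<le> B"
      using \<phi> by (auto simp: Cb_def bounded_iff)
    hence "integrable \<eta> \<phi>" by (rule bdd[OF CbM[OF \<phi>]])
    thus ?thesis using fubini[OF CbM[OF \<phi>]] eigen[OF \<phi>] by simp
  qed
  \<comment> \<open>Testing with the constant 1 identifies \<open>\<rho>\<close> with the total mass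
    of \<open>\<eta>\<close>. The sign matters because \<open>ennreal\<close> sends negative reals
    to 0.\<close>
  have "0 \<le> \<rho>"
  proof -
    let ?u = "restrict (\<lambda>_. 1 :: real) (topspace X)"
    have "continuous_map X euclidean ?u"
      by (rule continuous_map_eq[of _ _ "\<lambda>_. 1"]) auto
    hence "?u \<in> Cb X" by (auto simp: Cb_def image_constant_conv)
    note mean[OF this]
    moreover have "(\<integral>x. ?u x \<partial>\<nu>) = (\<integral>x. 1 \<partial>\<nu>)"
      by (rule Bochner_Integration.integral_cong) (simp_all add: sp)
    moreover have "(\<integral>x. ?u x \<partial>\<eta>) \<ge> 0"
      by (rule integral_nonneg_AE, rule AE_I2) (simp add: \<eta>_def)
    ultimately show ?thesis by (simp add: \<nu>.prob_space)
  qed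
  have \<eta>: "\<eta> = density \<nu> (\<lambda>_. ennreal \<rho>)"
  proof (rule finite_measure_eqI_Cb[OF X meas_eta])
    show "finite_measure (density \<nu> (\<lambda>_. ennreal \<rho>))"
      by (rule finite_measureI) (simp add: emeasure_density \<nu>.emeasure_space_1 ennreal_mult_eq_top_iff)
    show "(\<integral>x. \<phi> x \<partial>\<eta>) = (\<integral>x. \<phi> x \<partial>density \<nu> (\<lambda>_. ennreal \<rho>))" if "\<phi> \<in> Cb X" for \<phi> :: "'x \<Rightarrow> real"
      using mean[OF that] CbM[OF that] \<open>0 \<le> \<rho>\<close> by (simp add: integral_density)
  qed (simp_all add: \<eta>_def \<nu>)
  show "integrable \<nu> (transfer m f \<phi>)" if \<phi>: "integrable \<nu> \<phi>"
  proof -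
    have M: "\<phi> \<in> borel_measurable \<nu>" using \<phi> by simp
    have "integrable \<eta> \<phi>" using \<phi> \<open>0 \<le> \<rho>\<close> by (simp add: \<eta> integrable_density)
    \<comment> \<open>Fubini: the inner integral of an integrable function on the product is
      integrable in the remaining variable.\<close>
    hence "integrable \<nu> (\<lambda>x. \<integral>a. exp (f (T x a)) * \<phi> (T x a) \<partial>\<mu>)"
      using P.integrable_fst'[of "\<lambda>(x, a). exp (f (T x a)) * \<phi> (T x a)"] intble[OF M] by simp
    thus ?thesis using trans[OF M] by (simp cong: Bochner_Integration.integrable_cong)
  qed
  show "AE x in \<nu>. transfer m f \<phi> x = transfer m f \<psi> x"
    if "integrable \<nu> \<phi>" "integrable \<nu> \<psi>" and ae: "AE x in \<nu>. \<phi> x = \<psi> x"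
  proof -
    have M[measurable]: "\<phi> \<in> borel_measurable \<nu>" "\<psi> \<in> borel_measurable \<nu>" using that by simp_all
    have M'[measurable]: "\<phi> \<in> borel_measurable (borel_of X)" "\<psi> \<in> borel_measurable (borel_of X)"
      using M measurable_cong_sets[OF \<nu>(2) refl] by blast+
    have "AE x in \<eta>. \<phi> x = \<psi> x" unfolding \<eta> using ae by (simp add: AE_density)
    \<comment> \<open>Pulling an a.e. statement back through a pushforward requires the set where it
      holds to be measurable.\<close>
    moreover have "{x \<in> space (borel_of X). \<phi> x = \<psi> x} \<in> sets (borel_of X)" by measurable
    ultimately have "AE w in \<nu> \<Otimes>\<^sub>M \<mu>. 0 < ennreal (g w) \<longrightarrow> \<phi> (case w of (x, a) \<Rightarrow> T x a) = \<psi> (case w of (x, a) \<Rightarrow> T x a)"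
      unfolding \<eta>_def by (subst (asm) AE_distr_iff) (auto simp: AE_density)
    \<comment> \<open>The density is an exponential, hence positive everywhere, so the premise can
      be discharged.\<close>
    hence "AE w in \<nu> \<Otimes>\<^sub>M \<mu>. \<phi> (case w of (x, a) \<Rightarrow> T x a) = \<psi> (case w of (x, a) \<Rightarrow> T x a)"
      by eventually_elim (simp add: g_def split: prod.splits)
    \<comment> \<open>Almost every slice of a null set is null; for such \<open>x\<close> the two
      fibre integrals have a.e. equal integrands.\<close>
    hence "AE x in \<nu>. AE a in \<mu>. \<phi> (T x a) = \<psi> (T x a)"
      by (auto dest!: P.AE_pair)
    thus ?thesis
    proof (rule AE_mp, intro AE_I2 impI)
      fix x assume x: "x \<in> space \<nu>" and eq: "AE a in \<mu>. \<phi> (T x a) = \<psi> (T x a)"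
      have [measurable]: "T x \<in> measurable \<mu> (borel_of X)" using x sp by simp
      have "(\<integral>a. exp (f (T x a)) * \<phi> (T x a) \<partial>\<mu>) = (\<integral>a. exp (f (T x a)) * \<psi> (T x a) \<partial>\<mu>)"
        by (rule integral_cong_AE) (use eq in auto)
      thus "transfer m f \<phi> x = transfer m f \<psi> x" using trans x M by simp
    qed
  qed
qed

section \<open>The branch map on the product space\<close>

text \<open>With countably many second countable factors, measurability may be checked by
  coordinates: coordinate 0 is \<open>a\<close> and coordinate \<open>Suc n\<close> is
  \<open>x n\<close>.\<close>

lemma case_nat_measurable_euclidean:
  fixes M :: "'e::polish_space measure"
  assumes "sets M = sets borel"
  shows "(\<lambda>(x, a). case_nat a x) \<in> measurable (borel_of euclidean \<Otimes>\<^sub>M M) (borel_of (euclidean :: (nat \<Rightarrow> 'e) topology))"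
proof -
  note [measurable_cong] = assms borel_of_euclidean
  have [measurable]: "(\<lambda>w. fst w n) \<in> borel_measurable (borel_of (euclidean :: (nat \<Rightarrow> 'e) topology) \<Otimes>\<^sub>M M)" for n
    by (rule measurable_product_then_coordinatewise) measurable
  have "(\<lambda>(x, a). case_nat a x) \<in> borel_measurable (borel_of (euclidean :: (nat \<Rightarrow> 'e) topology) \<Otimes>\<^sub>M M)"
  proof (rule measurable_coordinatewise_then_product)
    show "(\<lambda>w. (case w of (x, a) \<Rightarrow> case_nat a x) n) \<in> borel_measurable (borel_of (euclidean :: (nat \<Rightarrow> 'e) topology) \<Otimes>\<^sub>M M)" for n
      by (cases n) (simp_all add: split_beta)
  qed
  thus ?thesis using measurable_cong_sets[OF refl borel_of_euclidean] by blast
qed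

section \<open>Separability and Borel structure of the \<ell>p spaces\<close>

text \<open>Cut off a small tail and round the remaining coordinates to rationals, spending half of
  \<open>e powr p\<close> on each. Lists of rationals encode the finitely supported centres as a
  countable type.\<close>

lemma lp_rational_dense:
  assumes p: "1 \<le> p" and x: "x \<in> lp_space p" and e: "0 < e"
  obtains l :: "rat list" where
    "(\<lambda>n. if n < length l then of_rat (l ! n) else 0) \<in> lp_space p"
    "lp_norm p (\<lambda>n. x n - (if n < length l then of_rat (l ! n) else 0)) < e"
proof -
  have S: "summable (\<lambda>n. \<bar>x n\<bar> powr p)" using x by (simp add: lp_space_def)
  have e': "0 < e powr p / 2" using e by simp
  obtain N where N: "(\<Sum>n. \<bar>x (n + N)\<bar> powr p) < e powr p / 2"
    using suminf_exist_split[OF e' S] by (metis abs_less_iff order_refl real_norm_def)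
  \<comment> \<open>Chosen so that \<open>N\<close> errors of size \<open>d powr p\<close> add up to
    at most \<open>e powr p / 2\<close>; the added 1 keeps the denominator nonzero when
    \<open>N\<close> is 0.\<close>
  define d where "d = (e powr p / (2 * (real N + 1))) powr (1 / p)"
  have d: "0 < d" "d powr p = e powr p / (2 * (real N + 1))"
    using e p by (auto simp: d_def powr_powr)
  have "\<exists>q. \<bar>x n - of_rat q\<bar> < d" for n
  proof -
    obtain q where "x n - d < of_rat q" "of_rat q < x n"
      using of_rat_dense[of "x n - d" "x n"] d by auto
    thus ?thesis by (intro exI[of _ q]) auto
  qed
  then obtain q where q: "\<And>n. \<bar>x n - of_rat (q n)\<bar> < d" by metis
  define l where "l = map q [0..<N]"
  define y where "y = (\<lambda>n. if n < length l then of_rat (l ! n) else (0::real))"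
  have y: "y n = (if n < N then of_rat (q n) else 0)" for n by (simp add: y_def l_def)
  have yl: "y \<in> lp_space p"
    unfolding lp_space_def by (auto intro!: summable_finite[of "{..<N}"] simp: y split: if_splits)
  have S': "summable (\<lambda>n. \<bar>x n - y n\<bar> powr p)"
    using lp_space_diff[OF p x yl] by (simp add: lp_space_def)
  have "(\<Sum>n<N. \<bar>x n - y n\<bar> powr p) \<le> (\<Sum>n<N. e powr p / (2 * (real N + 1)))"
  proof (rule sum_mono)
    fix n assume "n \<in> {..<N}"
    hence "\<bar>x n - y n\<bar> powr p \<le> d powr p"
      using q[of n] p by (intro powr_mono2) (auto simp: y)
    thus "\<bar>x n - y n\<bar> powr p \<le> e powr p / (2 * (real N + 1))" by (simp add: d)
  qed
  also have "\<dots> \<le> e powr p / 2" using e by (simp add: field_simps)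
  finally have 1: "(\<Sum>n<N. \<bar>x n - y n\<bar> powr p) \<le> e powr p / 2" .
  \<comment> \<open>Beyond \<open>N\<close> the approximant vanishes, so the tail of the difference
    is the tail of \<open>x\<close>. The strict inequality comes from the tail.\<close>
  have 2: "(\<Sum>n. \<bar>x n - y n\<bar> powr p) < e powr p"
    using suminf_split_initial_segment[OF S', of N] 1 N by (simp add: y)
  have "(\<Sum>n. \<bar>x n - y n\<bar> powr p) powr (1 / p) < (e powr p) powr (1 / p)"
    using 2 p S' by (intro powr_less_mono2 suminf_nonneg) auto
  hence "lp_norm p (\<lambda>n. x n - y n) < e" using e p by (simp add: lp_norm_def powr_powr)
  thus thesis using that[of l] yl by (simp add: y_def)
qed

lemma borel_measurable_lp_norm:
  assumes "\<And>n. (\<lambda>w. g w n) \<in> borel_measurable M"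
  shows "(\<lambda>w. lp_norm p (g w)) \<in> borel_measurable M"
  unfolding lp_norm_def using assms
  by (intro powr_real_measurable borel_measurable_suminf borel_measurable_abs borel_measurable_const)

text \<open>By separability an open set is a countable union of balls with rational data, and the
  distance to a fixed centre is a measurable expression in the coordinates.\<close>

lemma measurable_lpI:
  assumes p: "1 \<le> p" and g: "\<And>w. w \<in> space M \<Longrightarrow> g w \<in> lp_space p"
    and gn: "\<And>n. (\<lambda>w. g w n) \<in> borel_measurable M"
  shows "g \<in> measurable M (borel_of (lp_topology p))"
proof (rule measurable_borel_ofI)
  show "g w \<in> topspace (lp_topology p)" if "w \<in> space M" for w
    using g that by (simp add: topspace_lp[OF p])
next
  interpret L: Metric_space "lp_space p" "\<lambda>x y. lp_norm p (\<lambda>n. x n - y n)"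
    by (rule Metric_space_lp[OF p])
  fix U assume "openin (lp_topology p) U"
  hence U: "U \<subseteq> lp_space p" "\<And>x. x \<in> U \<Longrightarrow> \<exists>r>0. L.mball x r \<subseteq> U"
    by (auto simp: lp_topology_def L.openin_mtopology)
  define s :: "rat list \<Rightarrow> nat \<Rightarrow> real" where "s l n = (if n < length l then of_rat (l ! n) else 0)" for l n
  define I :: "(rat list \<times> rat) set" where "I = {(l, r). s l \<in> lp_space p \<and> L.mball (s l) (of_rat r) \<subseteq> U}"
  have "\<exists>i\<in>I. x \<in> L.mball (s (fst i)) (of_rat (snd i))" if xU: "x \<in> U" for x
  proof -
    obtain r where r: "r > 0" "L.mball x r \<subseteq> U" using U(2) xU by blast
    \<comment> \<open>With radius below \<open>r / 2\<close> and centre within \<open>q\<close> of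
      \<open>x\<close>, the triangle inequality keeps the rational ball inside the ball of radius
      \<open>r\<close> about \<open>x\<close>.\<close>
    obtain q where q: "0 < real_of_rat q" "real_of_rat q < r / 2"
      using of_rat_dense[OF half_gt_zero[OF r(1)]] by blast
    have x: "x \<in> lp_space p" using U(1) xU by blast
    obtain l where l: "s l \<in> lp_space p" "lp_norm p (\<lambda>n. x n - s l n) < of_rat q"
      using lp_rational_dense[OF p x q(1)] unfolding s_def by blast
    have "L.mball (s l) (of_rat q) \<subseteq> L.mball x r"
    proof (rule L.mball_subset)
      show "lp_norm p (\<lambda>n. s l n - x n) + of_rat q \<le> r" using l(2) q L.commute[of x "s l"] by linarith
    qed (rule x)
    hence "(l, q) \<in> I" using r l by (auto simp: I_def)
    moreover have "x \<in> L.mball (s l) (of_rat q)" using x l L.commute[of x "s l"] by simp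
    ultimately show ?thesis by force
  qed
  hence "U = (\<Union>i\<in>I. L.mball (s (fst i)) (of_rat (snd i)))" by (auto simp: I_def)
  hence "g -` U \<inter> space M = (\<Union>i\<in>I. g -` L.mball (s (fst i)) (of_rat (snd i)) \<inter> space M)" by blast
  \<comment> \<open>Ball membership also demands lying in the carrier, which holds for the values of
    \<open>g\<close> and for the centres indexed by \<open>I\<close>.\<close>
  also have "\<dots> = (\<Union>i\<in>I. {w \<in> space M. lp_norm p (\<lambda>n. s (fst i) n - g w n) < of_rat (snd i)})"
    by (rule SUP_cong[OF refl]) (use g in \<open>auto simp: I_def\<close>)
  also have "\<dots> \<in> sets M" by (intro sets.countable_UN'' countableI_type borel_measurable_less borel_measurable_lp_norm
        borel_measurable_diff borel_measurable_const gn)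
  finally show "g -` U \<inter> space M \<in> sets M" .
qed

text \<open>One term of the series is at most the whole sum, so each coordinate is 1-Lipschitz for
  the norm and therefore continuous.\<close>

lemma lp_coordinate_measurable:
  assumes p: "1 \<le> p"
  shows "(\<lambda>x. x n) \<in> borel_measurable (borel_of (lp_topology p))"
proof (rule continuous_map_borel_measurable)
  interpret L: Metric_space "lp_space p" "\<lambda>x y. lp_norm p (\<lambda>n. x n - y n)"
    by (rule Metric_space_lp[OF p])
  have le: "\<bar>x n\<bar> \<le> lp_norm p x" if "x \<in> lp_space p" for x
  proof -
    have "\<bar>x n\<bar> powr p \<le> (\<Sum>k. \<bar>x k\<bar> powr p)"
      using that sum_le_suminf[of "\<lambda>k. \<bar>x k\<bar> powr p" "{n}"] by (auto simp: lp_space_def)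
    hence "(\<bar>x n\<bar> powr p) powr (1 / p) \<le> lp_norm p x"
      unfolding lp_norm_def using p by (intro powr_mono2) auto
    thus ?thesis using p by (simp add: powr_powr)
  qed
  have "continuous_map L.mtopology Met_TC.mtopology (\<lambda>x. x n)"
    unfolding L.metric_continuous_map[OF Met_TC.Metric_space_axioms]
  proof (intro conjI ballI allI impI)
    fix a e assume a: "a \<in> lp_space p" and e: "0 < (e::real)"
    show "\<exists>\<delta>>0. \<forall>x. x \<in> lp_space p \<and> lp_norm p (\<lambda>n. a n - x n) < \<delta> \<longrightarrow> dist (a n) (x n) < e"
    proof (intro exI conjI allI impI)
      fix x assume "x \<in> lp_space p \<and> lp_norm p (\<lambda>n. a n - x n) < e"
      thus "dist (a n) (x n) < e"
        using le[OF lp_space_diff[OF p a, of x]] by (simp add: dist_real_def)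
    qed (rule e)
  qed simp
  thus "continuous_map (lp_topology p) euclidean (\<lambda>x. x n)" by (simp add: lp_topology_def)
qed

section \<open>The branch map on the \<ell>p spaces\<close>

text \<open>Weights bounded below by \<open>c\<close> make the inverse scaling a bounded operator of
  norm at most \<open>inverse c\<close>.\<close>

lemma inverse_weights_lp:
  assumes p: "1 \<le> p" and c: "0 < c" "\<And>n. c \<le> \<alpha> n" and x: "x \<in> lp_space p"
  shows "inverse_weights \<alpha> x \<in> lp_space p"
proof -
  have le: "\<bar>inverse_weights \<alpha> x n\<bar> powr p \<le> inverse c powr p * \<bar>x n\<bar> powr p" for n
  proof -
    have "\<bar>inverse_weights \<alpha> x n\<bar> \<le> inverse c * \<bar>x n\<bar>"
    proof -
      have "\<bar>inverse (\<alpha> n)\<bar> \<le> inverse c"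
        using c(1) c(2)[of n] le_imp_inverse_le[of c "\<alpha> n"] by simp
      thus ?thesis by (simp add: inverse_weights_def abs_mult mult_right_mono)
    qed
    hence "\<bar>inverse_weights \<alpha> x n\<bar> powr p \<le> (inverse c * \<bar>x n\<bar>) powr p"
      using p by (intro powr_mono2) auto
    thus ?thesis by (simp only: powr_mult abs_ge_zero)
  qed
  have "summable (\<lambda>n. inverse c powr p * \<bar>x n\<bar> powr p)"
    using x unfolding lp_space_def by (intro summable_mult) simp
  hence "summable (\<lambda>n. \<bar>inverse_weights \<alpha> x n\<bar> powr p)"
    by (rule summable_comparison_test'[where N = 0]) (simp add: le)
  thus ?thesis by (simp add: lp_space_def)
qed

lemma case_nat_lp: "x \<in> lp_space p \<Longrightarrow> case_nat a x \<in> lp_space p"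
  unfolding lp_space_def by (subst mem_Collect_eq, subst summable_Suc_iff [symmetric]) simp

text \<open>Each output coordinate is either \<open>a\<close> or a constant multiple of one
  coordinate of \<open>x\<close>, so the coordinate criterion applies.\<close>

lemma case_nat_measurable_lp:
  assumes p: "1 \<le> p" and c: "0 < c" "\<And>n. c \<le> \<alpha> n" and M: "sets M = sets (borel :: real measure)"
  shows "(\<lambda>(x, a). case_nat a (inverse_weights \<alpha> x))
    \<in> measurable (borel_of (lp_topology p) \<Otimes>\<^sub>M M) (borel_of (lp_topology p))"
proof (rule measurable_lpI[OF p])
  note [measurable_cong] = M and [measurable] = lp_coordinate_measurable[OF p]
  show "(\<lambda>w. (case w of (x, a) \<Rightarrow> case_nat a (inverse_weights \<alpha> x)) n)
      \<in> borel_measurable (borel_of (lp_topology p) \<Otimes>\<^sub>M M)" for n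
    by (cases n) (simp_all add: split_beta inverse_weights_def)
qed (auto simp: space_pair_measure topspace_lp[OF p] intro!: case_nat_lp inverse_weights_lp[OF p c])

lemma metrizable_lp: "1 \<le> p \<Longrightarrow> metrizable_space (lp_topology p)"
  unfolding lp_topology_def by (rule Metric_space.metrizable_space_mtopology[OF Metric_space_lp])

section \<open>The two settings as instances of the general branch map\<close>

theorem proposition3p12:
  shows
    "(\<forall>(X :: (nat \<Rightarrow> 'e::polish_space) topology) (\<mu> :: 'e measure) m f \<nu>.
        X = euclidean \<and>
        is_borel_prob euclidean \<mu> \<and>
        m = (\<lambda>x. prepend_law \<mu> X x) \<and>
        f \<in> Cb X \<and>
        conformal X m f \<nu>
        \<longrightarrow>
        (\<forall>\<phi>\<in>L1_dom X m f \<nu>. integrable \<nu> (transfer m f \<phi>)) \<and>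
        (\<forall>\<phi>\<in>L1_dom X m f \<nu>. \<forall>\<psi>\<in>L1_dom X m f \<nu>.
           (AE x in \<nu>. \<phi> x = \<psi> x) \<longrightarrow> (AE x in \<nu>. transfer m f \<phi> x = transfer m f \<psi> x)))
     \<and>
     (\<forall>(X :: (nat \<Rightarrow> real) topology) (p::real) (\<alpha> :: nat \<Rightarrow> real) c c' (\<mu> :: real measure) m f \<nu>.
        1 \<le> p \<and> X = lp_topology p \<and>
        0 < c \<and> c < c' \<and> (\<forall>n. \<alpha> n \<in> {c<..<c'}) \<and>
        is_borel_prob euclidean \<mu> \<and> fully_supported euclidean \<mu> \<and>
        m = (\<lambda>x. prepend_law \<mu> X (inverse_weights \<alpha> x)) \<and>
        f \<in> Cb X \<and>
        conformal X m f \<nu>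
        \<longrightarrow>
        (\<forall>\<phi>\<in>L1_dom X m f \<nu>. integrable \<nu> (transfer m f \<phi>)) \<and>
        (\<forall>\<phi>\<in>L1_dom X m f \<nu>. \<forall>\<psi>\<in>L1_dom X m f \<nu>.
           (AE x in \<nu>. \<phi> x = \<psi> x) \<longrightarrow> (AE x in \<nu>. transfer m f \<phi> x = transfer m f \<psi> x)))"
proof ((rule conjI; intro allI impI), goal_cases)
  case (1 X \<mu> m f \<nu>)
  hence H: "metrizable_space X" "prob_space \<mu>" "f \<in> Cb X" "conformal X m f \<nu>"
    "(\<lambda>(x, a). case_nat a x) \<in> measurable (borel_of X \<Otimes>\<^sub>M \<mu>) (borel_of X)"
    "\<And>x. m x = distr \<mu> (borel_of X) (\<lambda>a. case_nat a x)"
    using case_nat_measurable_euclidean[of \<mu>]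
    by (auto simp: is_borel_prob_def borel_of_euclidean metrizable_space_euclidean prepend_law_def)
  \<comment> \<open>Here \<open>T x a\<close> is \<open>case_nat a x\<close>.\<close>
  show ?case
    using transfer_L1[OF H(1,2,5) _ H(3,4)] H(6) by (simp add: L1_dom_def)
next
  case (2 X p \<alpha> c c' \<mu> m f \<nu>)
  hence p: "1 \<le> p" and c: "0 < c" "\<And>n. c \<le> \<alpha> n" and \<mu>: "sets \<mu> = sets borel"
    by (auto simp: is_borel_prob_def borel_of_euclidean less_imp_le)
  from 2 have H: "metrizable_space X" "prob_space \<mu>" "f \<in> Cb X" "conformal X m f \<nu>"
    "(\<lambda>(x, a). case_nat a (inverse_weights \<alpha> x)) \<in> measurable (borel_of X \<Otimes>\<^sub>M \<mu>) (borel_of X)"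
    "\<And>x. m x = distr \<mu> (borel_of X) (\<lambda>a. case_nat a (inverse_weights \<alpha> x))"
    using case_nat_measurable_lp[OF p c \<mu>]
    by (auto simp: is_borel_prob_def metrizable_lp prepend_law_def)
  \<comment> \<open>Here \<open>T x a\<close> is
    \<open>case_nat a (inverse_weights \<alpha> x)\<close>.\<close>
  show ?case
    using transfer_L1[OF H(1,2,5) _ H(3,4)] H(6) by (simp add: L1_dom_def)
qed

end
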